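(* Let $(X,\{\leq\})$ be a relator space where $X$ is a set, $\leq$ is a total order on $X$, and $\bar{\delta}_{\leq}$ is the proximity induced by $\leq$. Then the proximity graph $\bar{\mathcal{P}}_\leq(X)$ is equivalent to the Hasse diagram $\mathcal{H}s_\leq(X)$.
   Context: A relator space $(X,\mathcal{R})$ is a set $X$ together with a family $\mathcal{R}$ of relations on $X$. A total order is a partial order (reflexive, antisymmetric, transitive) such that for all $a,b$ either $a\leq b$ or $b\leq a$. Induced proximity: for $a,b\in X$, $\bar{\delta}_\leq(a,b)=0$ if and only if $a\leq b$ and there is no $x\in X\setminus\{a,b\}$ with $a\leq x\leq b$; and $\bar{\delta}_\leq(a,b)=1$ if and only if $a\leq b$ and there is an $x\in X\setminus\{a,b\}$ with $a\leq x\leq b$. (If $a\leq b$ fails, no value is assigned to $\bar{\delta}_\leq(a,b)$.) Graphs: $\bar{\mathcal{O}}_\leq(X)$ is the directed graph with vertex set $X$ having an edge $a\to b$ if $a\leq b$. $\bar{\mathcal{P}}_\leq(X)$ is the directed graph with vertex set $X$ having an edge $a\to b$ if $\bar{\delta}_\leq(a,b)=0$. A transitive reduction of a directed graph $D_1$ is a directed graph $D_2$ with the same vertex set but a reduced edge set, such that if there is a path between vertices $v_1$ and $v_2$ in $D_1$ then there is also such a path in $D_2$. The Hasse diagram $\mathcal{H}s_\leq(X)$ is the transitive reduction of $\bar{\mathcal{O}}_\leq(X)$. "Equivalent" is used in the sense that the two graphs are the same.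
   Formalization: A transitive reduction need not exist (e.g. for the rationals), so equality is proved whenever the Hasse diagram exists, and existence is proved when all intervals are finite; paths have at least one edge, and a reduction is a subgraph minimal under edge deletion. *)

theory Defs
  imports Main "Graph_Theory.Graph_Theory"
begin

definition relator_space :: "'a set \<Rightarrow> 'a rel set \<Rightarrow> bool" where
  "relator_space X \<R> \<longleftrightarrow> (\<forall>r\<in>\<R>. r \<subseteq> X \<times> X)"

text \<open>
  Throughout, \<^term>\<open>(a, b) \<in> r\<close> stands for \<open>a \<le> b\<close>. The induced proximity takes the values 0 and 1
  and is undefined (\<^term>\<open>None\<close>) where \<open>a \<le> b\<close> fails. Note that its value at \<open>(a, a)\<close>
  is 0 when \<open>r\<close> is reflexive and antisymmetric, so the proximity graph has a loop at every vertex.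
\<close>

definition induced_proximity :: "'a set \<Rightarrow> 'a rel \<Rightarrow> 'a \<Rightarrow> 'a \<Rightarrow> nat option" where
  "induced_proximity X r a b =
     (if (a, b) \<in> r
      then Some (if \<exists>x \<in> X - {a, b}. (a, x) \<in> r \<and> (x, b) \<in> r then 1 else 0)
      else None)"

definition order_graph :: "'a set \<Rightarrow> 'a rel \<Rightarrow> 'a pair_pre_digraph" where
  "order_graph X r = \<lparr> pverts = X, parcs = {(a, b). a \<in> X \<and> b \<in> X \<and> (a, b) \<in> r} \<rparr>"

definition proximity_graph :: "'a set \<Rightarrow> 'a rel \<Rightarrow> 'a pair_pre_digraph" where
  "proximity_graph X r =
     \<lparr> pverts = X, parcs = {(a, b). a \<in> X \<and> b \<in> X \<and> induced_proximity X r a b = Some 0} \<rparr>"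

text \<open>
  Paths are taken to have at least one arc. Hence a loop, the only closed
  path in the graph of a partial order, is a path that a transitive reduction has to keep; if the
  empty path counted, the reduction would drop the loops and differ from the proximity graph.
\<close>

definition preserves_paths :: "'a pair_pre_digraph \<Rightarrow> 'a pair_pre_digraph \<Rightarrow> bool" where
  "preserves_paths D2 D1 \<longleftrightarrow>
     (\<forall>v1 \<in> pverts D1. \<forall>v2 \<in> pverts D1.
        v1 \<rightarrow>\<^sup>+\<^bsub>with_proj D1\<^esub> v2 \<longrightarrow> v1 \<rightarrow>\<^sup>+\<^bsub>with_proj D2\<^esub> v2)"

text \<open>
  ``Reduced edge set'' is rendered as: a subset of the arcs from which nothing more can be removed
  without losing a path. Such a subgraph need not exist for an infinite graph, so this is
  a predicate on candidates \<open>D2\<close> and not a function of \<open>D1\<close>.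
\<close>

definition transitive_reduction :: "'a pair_pre_digraph \<Rightarrow> 'a pair_pre_digraph \<Rightarrow> bool" where
  "transitive_reduction D2 D1 \<longleftrightarrow>
     spanning (with_proj D2) (with_proj D1) \<and> preserves_paths D2 D1 \<and>
     (\<forall>D. spanning (with_proj D) (with_proj D2) \<and> preserves_paths D D1 \<longrightarrow> D = D2)"

definition hasse_diagram :: "'a set \<Rightarrow> 'a rel \<Rightarrow> 'a pair_pre_digraph \<Rightarrow> bool" where
  "hasse_diagram X r H \<longleftrightarrow> transitive_reduction H (order_graph X r)"

end

theory Submission
  imports Defs
begin

text \<open>
  A path in a subgraph of the order graph climbs weakly, so every vertex on it lies between its end
  points. Two consequences carry the proof.

  An arc with nothing strictly in between cannot be bypassed: any path that joins its ends contains
  the arc itself (\<open>arc_of_trancl_if_no_between\<close>). Hence every path-preserving subgraph contains the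
  proximity graph.

  In a path-preserving subgraph, an arc \<open>a \<rightarrow> b\<close> with some \<open>x\<close> strictly in between can always be
  bypassed: there are paths from \<open>a\<close> to \<open>x\<close> and from \<open>x\<close> to \<open>b\<close>; the first stops short of \<open>b\<close> and
  the second starts beyond \<open>a\<close>, so neither contains the arc (\<open>trancl_remove_bypassed_arc\<close>). Hence a
  subgraph that is minimal among the path-preserving ones has no such arc and is contained in the
  proximity graph.

  Together these say that a transitive reduction, if there is one, is the proximity graph, and that
  the proximity graph is a transitive reduction as soon as it preserves paths. When all
  intervals are finite it does, because one can subdivide \<open>a \<le> b\<close> until only covering pairs are
  left (\<open>trancl_covers_if_finite_intervals\<close>).
\<close>

section \<open>Paths along a partial order\<close>

lemma trancl_subset_trans:
  assumes "E \<subseteq> r" "trans r"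
  shows "E\<^sup>+ \<subseteq> r"
  using assms trancl_id trancl_mono_subset by blast

text \<open>
  All vertices of the path lie between \<open>a\<close> and \<open>b\<close>, hence are \<open>a\<close> or \<open>b\<close>; so at some step the path
  goes from \<open>a\<close> to \<open>b\<close> directly. For \<open>a = b\<close> the arc obtained is a loop.
\<close>

lemma arc_of_trancl_if_no_between:
  assumes "E \<subseteq> r" "trans r" "(a, b) \<in> E\<^sup>+"
    and "\<And>x. (a, x) \<in> r \<Longrightarrow> (x, b) \<in> r \<Longrightarrow> x \<in> {a, b}"
  shows "(a, b) \<in> E"
  using assms(3,4)
proof (induction rule: trancl_induct)
  case (base y)
  then show ?case by simp
next
  case (step y z)
  have "(a, y) \<in> r" "(y, z) \<in> r"
    using step.hyps trancl_subset_trans[OF assms(1,2)] assms(1) by auto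
  then show ?case
    using step by blast
qed

text \<open>
  A path that uses the arc \<open>(a, b)\<close> starts weakly below \<open>a\<close> and ends weakly above \<open>b\<close>. The
  reflexive closure covers paths that start at \<open>a\<close> or end at \<open>b\<close>.
\<close>

lemma trancl_avoid_arc:
  assumes "E \<subseteq> r" "trans r" "(u, v) \<in> E\<^sup>+"
    and "\<not> ((u, a) \<in> r\<^sup>= \<and> (b, v) \<in> r\<^sup>=)"
  shows "(u, v) \<in> (E - {(a, b)})\<^sup>+"
  using assms(3,4)
proof (induction rule: trancl_induct)
  case (base y)
  then show ?case by auto
next
  case (step y z)
  have "(u, y) \<in> r" "(y, z) \<in> r"
    using step.hyps trancl_subset_trans[OF assms(1,2)] assms(1) by auto
  then have "\<not> ((u, a) \<in> r\<^sup>= \<and> (b, y) \<in> r\<^sup>=)" "(y, z) \<noteq> (a, b)"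
    using step.prems \<open>trans r\<close> by (auto dest: transD)
  then show ?case
    using step by (meson DiffI singletonD trancl.trancl_into_trancl)
qed

text \<open>
  Neither the path from \<open>a\<close> to \<open>x\<close> nor the one from \<open>x\<close> to \<open>b\<close> can use the arc \<open>(a, b)\<close>, since it
  would have to pass \<open>b\<close> below \<open>x\<close>, respectively \<open>a\<close> above \<open>x\<close>. Their concatenation replaces the arc.
\<close>

lemma trancl_remove_bypassed_arc:
  assumes "E \<subseteq> r" "trans r" "antisym r"
    and "(a, x) \<in> E\<^sup>+" "(x, b) \<in> E\<^sup>+" "x \<notin> {a, b}"
  shows "E\<^sup>+ \<subseteq> (E - {(a, b)})\<^sup>+"
proof -
  have "(a, x) \<in> r" "(x, b) \<in> r"
    using assms trancl_subset_trans[OF assms(1,2)] by auto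
  then have "(b, x) \<notin> r\<^sup>=" "(x, a) \<notin> r\<^sup>="
    using assms(3,6) by (auto dest: antisymD)
  then have "(a, b) \<in> (E - {(a, b)})\<^sup>+"
    using trancl_avoid_arc[OF assms(1,2,4)] trancl_avoid_arc[OF assms(1,2,5)]
    by (blast intro: trancl_trans)
  then have "E \<subseteq> (E - {(a, b)})\<^sup>+"
    by auto
  then show ?thesis
    by (rule trancl_subset_trans) (rule trans_trancl)
qed

text \<open>
  By induction on the size of the interval: an element strictly between \<open>a\<close> and \<open>b\<close> splits it into
  two intervals, each of which lacks one of the end points.
\<close>

lemma trancl_covers_if_finite_intervals:
  assumes "trans r" "antisym r"
    and fin: "\<And>a b. finite {x. (a, x) \<in> r \<and> (x, b) \<in> r}"
    and covers: "\<And>a b. (a, b) \<in> r \<Longrightarrow> (\<And>x. (a, x) \<in> r \<Longrightarrow> (x, b) \<in> r \<Longrightarrow> x \<in> {a, b})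
      \<Longrightarrow> (a, b) \<in> C"
    and refl: "\<And>a b. (a, b) \<in> r \<Longrightarrow> (a, a) \<in> r \<and> (b, b) \<in> r"
    and "(a, b) \<in> r"
  shows "(a, b) \<in> C\<^sup>+"
  using \<open>(a, b) \<in> r\<close>
proof (induction "card {x. (a, x) \<in> r \<and> (x, b) \<in> r}" arbitrary: a b rule: less_induct)
  case less
  show ?case
  proof (cases "\<exists>x. (a, x) \<in> r \<and> (x, b) \<in> r \<and> x \<notin> {a, b}")
    case False
    then show ?thesis
      using covers[OF less.prems] by blast
  next
    case True
    then obtain x where x: "(a, x) \<in> r" "(x, b) \<in> r" "x \<noteq> a" "x \<noteq> b"
      by auto
    have "{y. (a, y) \<in> r \<and> (y, x) \<in> r} \<subset> {y. (a, y) \<in> r \<and> (y, b) \<in> r}"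
    proof
      show "{y. (a, y) \<in> r \<and> (y, x) \<in> r} \<subseteq> {y. (a, y) \<in> r \<and> (y, b) \<in> r}"
        using x transD[OF assms(1)] by blast
      show "{y. (a, y) \<in> r \<and> (y, x) \<in> r} \<noteq> {y. (a, y) \<in> r \<and> (y, b) \<in> r}"
        using x less.prems refl[of a b] antisymD[OF assms(2)] by blast
    qed
    moreover have "{y. (x, y) \<in> r \<and> (y, b) \<in> r} \<subset> {y. (a, y) \<in> r \<and> (y, b) \<in> r}"
    proof
      show "{y. (x, y) \<in> r \<and> (y, b) \<in> r} \<subseteq> {y. (a, y) \<in> r \<and> (y, b) \<in> r}"
        using x transD[OF assms(1)] by blast
      show "{y. (x, y) \<in> r \<and> (y, b) \<in> r} \<noteq> {y. (a, y) \<in> r \<and> (y, b) \<in> r}"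
        using x less.prems refl[of a b] antisymD[OF assms(2)] by blast
    qed
    ultimately have "(a, x) \<in> C\<^sup>+" "(x, b) \<in> C\<^sup>+"
      using x fin by (auto intro!: less.hyps psubset_card_mono)
    then show ?thesis
      by (rule trancl_trans)
  qed
qed

section \<open>The graphs of an order as sets of pairs\<close>

lemma spanning_with_proj_iff:
  "spanning (with_proj D) (with_proj G) \<longleftrightarrow>
     pverts D = pverts G \<and> parcs D \<subseteq> parcs G \<and> parcs G \<subseteq> pverts G \<times> pverts G"
  by (auto simp: spanning_def subgraph_def compatible_def wf_digraph_def)

lemma pverts_simps [simp]:
  "pverts (order_graph X r) = X" "pverts (proximity_graph X r) = X"
  by (simp_all add: order_graph_def proximity_graph_def)

lemma parcs_order_graph:
  assumes "r \<subseteq> X \<times> X"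
  shows "parcs (order_graph X r) = r"
  using assms by (auto simp: order_graph_def)

lemma parcs_proximity_graph_iff:
  assumes "r \<subseteq> X \<times> X"
  shows "(a, b) \<in> parcs (proximity_graph X r) \<longleftrightarrow>
    (a, b) \<in> r \<and> (\<forall>x. (a, x) \<in> r \<longrightarrow> (x, b) \<in> r \<longrightarrow> x \<in> {a, b})"
  using assms by (auto simp: proximity_graph_def induced_proximity_def split: if_splits)

lemma preserves_paths_order_graph_iff:
  assumes "r \<subseteq> X \<times> X" "trans r"
  shows "preserves_paths D (order_graph X r) \<longleftrightarrow> r \<subseteq> (parcs D)\<^sup>+"
  using assms by (auto simp: preserves_paths_def parcs_order_graph trancl_id)

lemma hasse_diagram_iff:
  assumes "r \<subseteq> X \<times> X" "trans r"
  shows "hasse_diagram X r H \<longleftrightarrow> pverts H = X \<and> parcs H \<subseteq> r \<and> r \<subseteq> (parcs H)\<^sup>+ \<and>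
    (\<forall>E \<subseteq> parcs H. r \<subseteq> E\<^sup>+ \<longrightarrow> E = parcs H)"
    (is "?L \<longleftrightarrow> ?R")
proof
  assume L: ?L
  have "E = parcs H" if "E \<subseteq> parcs H" "r \<subseteq> E\<^sup>+" for E
  proof -
    have "\<lparr>pverts = X, parcs = E\<rparr> = H"
      using L that assms
      by (auto simp: hasse_diagram_def transitive_reduction_def spanning_with_proj_iff
          preserves_paths_order_graph_iff parcs_order_graph)
    then show ?thesis
      by auto
  qed
  then show ?R
    using L assms
    by (auto simp: hasse_diagram_def transitive_reduction_def spanning_with_proj_iff
          preserves_paths_order_graph_iff parcs_order_graph)
next
  assume ?R
  then show ?L
    using assms
    by (auto simp: hasse_diagram_def transitive_reduction_def spanning_with_proj_iff
          preserves_paths_order_graph_iff parcs_order_graph intro!: pair_pre_digraph.equality)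
qed

section \<open>The proximity graph as transitive reduction\<close>

lemma parcs_proximity_graph_subset:
  assumes "r \<subseteq> X \<times> X" "trans r" "E \<subseteq> r" "r \<subseteq> E\<^sup>+"
  shows "parcs (proximity_graph X r) \<subseteq> E"
  using assms
  by (auto simp: parcs_proximity_graph_iff intro!: arc_of_trancl_if_no_between[of E r])

lemma hasse_diagram_unique:
  assumes r: "r \<subseteq> X \<times> X" and po: "trans r" "antisym r" and H: "hasse_diagram X r H"
  shows "proximity_graph X r = H"
proof (rule pair_pre_digraph.equality)
  note H' = H[unfolded hasse_diagram_iff[OF r po(1)]]
  show "pverts (proximity_graph X r) = pverts H"
    using H' by simp
  have "parcs H \<subseteq> parcs (proximity_graph X r)"
  proof (rule subrelI)
    fix a b
    assume ab: "(a, b) \<in> parcs H"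
    have "x \<in> {a, b}" if x: "(a, x) \<in> r" "(x, b) \<in> r" for x
    proof (rule ccontr)
      assume "x \<notin> {a, b}"
      \<comment> \<open>Otherwise deleting \<open>(a, b)\<close> would give a smaller graph with the same paths.\<close>
      then have "(parcs H)\<^sup>+ \<subseteq> (parcs H - {(a, b)})\<^sup>+"
        using H' po x by (intro trancl_remove_bypassed_arc[of "parcs H" r]) auto
      then have "parcs H - {(a, b)} = parcs H"
        using H' by blast
      then show False
        using ab by blast
    qed
    then show "(a, b) \<in> parcs (proximity_graph X r)"
      using ab H' by (auto simp: parcs_proximity_graph_iff[OF r])
  qed
  then show "parcs (proximity_graph X r) = parcs H"
    using parcs_proximity_graph_subset[OF r po(1)] H' by blast
qed simp

lemma hasse_diagram_proximity_graph:
  assumes r: "r \<subseteq> X \<times> X" and po: "trans r" "antisym r" "refl_on X r"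
    and fin: "\<And>a b. finite {x. (a, x) \<in> r \<and> (x, b) \<in> r}"
  shows "hasse_diagram X r (proximity_graph X r)"
proof -
  have sub: "parcs (proximity_graph X r) \<subseteq> r"
    by (auto simp: parcs_proximity_graph_iff[OF r])
  have "(a, b) \<in> (parcs (proximity_graph X r))\<^sup>+" if "(a, b) \<in> r" for a b
    by (rule trancl_covers_if_finite_intervals[OF po(1,2) fin _ _ that])
      (use r po(3) in \<open>auto simp: parcs_proximity_graph_iff[OF r] dest: refl_onD\<close>)
  moreover have "E = parcs (proximity_graph X r)"
    if "E \<subseteq> parcs (proximity_graph X r)" "r \<subseteq> E\<^sup>+" for E
    using parcs_proximity_graph_subset[OF r po(1) _ that(2)] sub that(1) by blast
  ultimately show ?thesis
    using sub by (simp add: hasse_diagram_iff[OF r po(1)] subrelI)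
qed

theorem theorem4:
  fixes X :: "'a set" and r :: "'a rel"
  assumes "relator_space X {r}"
    and "linear_order_on X r"
  shows "(\<forall>H. hasse_diagram X r H \<longrightarrow> proximity_graph X r = H) \<and>
    ((\<forall>a\<in>X. \<forall>b\<in>X. finite {x \<in> X. (a, x) \<in> r \<and> (x, b) \<in> r}) \<longrightarrow>
       hasse_diagram X r (proximity_graph X r))"
proof (intro conjI impI allI)
  have r: "r \<subseteq> X \<times> X"
    using assms(1) by (simp add: relator_space_def)
  have po: "trans r" "antisym r" "refl_on X r"
    using assms(2) by (auto simp: linear_order_on_def partial_order_on_def preorder_on_def)
  show "proximity_graph X r = H" if "hasse_diagram X r H" for H
    using hasse_diagram_unique[OF r po(1,2) that] .
  assume fin: "\<forall>a\<in>X. \<forall>b\<in>X. finite {x \<in> X. (a, x) \<in> r \<and> (x, b) \<in> r}"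
  have "finite {x. (a, x) \<in> r \<and> (x, b) \<in> r}" for a b
  proof (cases "a \<in> X \<and> b \<in> X")
    case True
    moreover have "{x. (a, x) \<in> r \<and> (x, b) \<in> r} = {x \<in> X. (a, x) \<in> r \<and> (x, b) \<in> r}"
      using r by auto
    ultimately show ?thesis
      using fin by simp
  next
    case False
    then have "{x. (a, x) \<in> r \<and> (x, b) \<in> r} = {}"
      using r by auto
    then show ?thesis
      by (simp only: finite.emptyI)
  qed
  then show "hasse_diagram X r (proximity_graph X r)"
    using hasse_diagram_proximity_graph[OF r po] by blast
qed

end
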